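(* Let $p\in(0,1)$, let $f\in\mathcal{A}(p)$ with $f(z)\neq 0$ for $z\in\mathbb{D}\setminus\{0\}$, and let $n\ge 3$ be an integer. Put $g(z)=z/f(z)$ and $\alpha_k=-g^{(k+2)}(0)$ for $k\ge 0$. If $$\sum_{k=0}^{n-3}\frac{k+1}{(k+2)!}|\alpha_k|+\frac{n-1}{n!}\left|g^{(n)}(z)\right|\le 1\qquad\text{for all } z\in\mathbb{D},$$ then $f$ is univalent in $\mathbb{D}$. The result is sharp, in that equality holds in the inequality $\sum_{k=0}^{n-3}\frac{k+1}{(k+2)!}|\alpha_k|+\frac{n-1}{n!}\left|g^{(n)}(z)\right|\le 1$ (for all $z\in\mathbb{D}$), with $g$ and $\alpha_k$ formed from the function in question in place of $f$, for the function $$k_p(z)=\frac{-pz}{(z-p)(1-pz)}$$ for all $n\ge 3$, and, for each $n\ge 3$, for the function $$f_n(z)=\frac{z}{1-\left(\frac1p+\frac{p^{n-1}}{n-1}\right)z+\frac{z^n}{n-1}},\qquad z\in\mathbb{D}.$$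
   Context: $\mathbb{D}=\{z\in\mathbb{C}:|z|<1\}$. For $p\in(0,1)$, $\mathcal{A}(p)$ is the class of all functions $f$ that are holomorphic in $\mathbb{D}\setminus\{p\}$, have a simple pole at $z=p$ (with nonzero residue), and satisfy $f(0)=0$ and $f'(0)=1$. Univalent in $\mathbb{D}$ means one-to-one in $\mathbb{D}$ as a map into the Riemann sphere, with $f(p)=\infty$. The function $g(z)=z/f(z)$ is understood with its removable singularities filled in (value $1$ at $z=0$ and $0$ at $z=p$), so it is analytic in $\mathbb{D}$ when $f$ does not vanish on $\mathbb{D}\setminus\{0\}$; $g^{(j)}$ denotes its $j$-th derivative. *)

theory Defs
  imports "HOL-Complex_Analysis.Complex_Analysis"
begin

definition class_A :: "real \<Rightarrow> (complex \<Rightarrow> complex) set" where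
  "class_A p = {f. f holomorphic_on (ball 0 1 - {complex_of_real p})
                 \<and> is_pole f (complex_of_real p) \<and> zorder f (complex_of_real p) = - 1
                 \<and> f 0 = 0 \<and> deriv f 0 = 1}"

text \<open>
  A meromorphic function as a map into the Riemann sphere \<open>\<complex> \<union> {\<infinity>}\<close>, with \<^const>\<open>None\<close> as
  the point at infinity. The value that the HOL function happens to have at a pole is
  arbitrary; this map discards it.
\<close>

definition to_sphere :: "(complex \<Rightarrow> complex) \<Rightarrow> complex \<Rightarrow> complex option" where
  "to_sphere f z = (if is_pole f z then None else Some (f z))"

definition univalent_in_disc :: "(complex \<Rightarrow> complex) \<Rightarrow> bool" where
  "univalent_in_disc f \<longleftrightarrow> inj_on (to_sphere f) (ball 0 1)"

definition nonvanishing :: "(complex \<Rightarrow> complex) \<Rightarrow> bool" where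
  "nonvanishing f \<longleftrightarrow> (\<forall>z\<in>ball 0 1 - {0}. to_sphere f z \<noteq> Some 0)"

definition g_of :: "(complex \<Rightarrow> complex) \<Rightarrow> complex \<Rightarrow> complex" where
  "g_of f = remove_sings (\<lambda>z. z / f z)"

definition alpha :: "(complex \<Rightarrow> complex) \<Rightarrow> nat \<Rightarrow> complex" where
  "alpha f k = - (deriv ^^ (k + 2)) (g_of f) 0"

definition coeff_bound :: "nat \<Rightarrow> (complex \<Rightarrow> complex) \<Rightarrow> complex \<Rightarrow> real" where
  "coeff_bound n f z =
     (\<Sum>k = 0..n - 3. (real k + 1) / fact (k + 2) * cmod (alpha f k))
     + (real n - 1) / fact n * cmod ((deriv ^^ n) (g_of f) z)"

definition k_fun :: "real \<Rightarrow> complex \<Rightarrow> complex" where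
  "k_fun p z = - of_real p * z / ((z - of_real p) * (1 - of_real p * z))"

definition f_fun :: "real \<Rightarrow> nat \<Rightarrow> complex \<Rightarrow> complex" where
  "f_fun p n z =
     z / (1 - (1 / of_real p + of_real p ^ (n - 1) / (of_nat n - 1)) * z + z ^ n / (of_nat n - 1))"

end

theory Submission
  imports Defs
begin

text \<open>
  With \<open>g = z/f\<close> one has \<open>1/f(z) = 1/z + H(z)\<close> for the analytic function \<open>H(z) = (g(z) - 1)/z\<close>, and
  \<open>z\<^sup>2 H'(z) = z g'(z) - g(z) + 1\<close>. The right-hand side vanishes at \<open>0\<close> and has derivative \<open>z g''(z)\<close>;
  integrating the Taylor estimate of \<open>g''\<close> along the radius bounds it by the left-hand side of the
  hypothesis times \<open>\<bar>z\<bar>\<^sup>2\<close>. Hence \<open>\<bar>H'\<bar> \<le> 1\<close>, so \<open>H\<close> moves two points apart by at most \<open>\<bar>z - w\<bar>\<close>, whereas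
  \<open>1/z\<close> moves them apart by \<open>\<bar>z - w\<bar>/\<bar>z w\<bar> > \<bar>z - w\<bar>\<close>, and \<open>1/f\<close> is injective. For sharpness,
  \<open>k\<^sub>p\<close> is \<open>f\<^sub>n\<close> with \<open>n = 2\<close>, so both extremal functions come from one trinomial \<open>g\<close>.
\<close>

section \<open>Majorants along radii\<close>

text \<open>The mean value inequality for the path \<open>F (t * z)\<close>,
  \<open>0 \<le> t \<le> 1\<close>, whose speed is dominated by the derivative of
  \<open>\<phi> (t * cmod z)\<close>. Giving the majorant as an antiderivative \<open>\<phi>\<close>
  means that later uses only differentiate polynomials instead of integrating.\<close>

lemma radial_bound:
  fixes F :: "complex \<Rightarrow> complex" and \<phi> \<phi>' :: "real \<Rightarrow> real"
  assumes F: "F holomorphic_on ball 0 r" and z: "z \<in> ball 0 r"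
    and \<phi>: "\<And>t. (\<phi> has_real_derivative \<phi>' t) (at t)"
    and bound: "\<And>w. w \<in> ball 0 r \<Longrightarrow> cmod (deriv F w) \<le> \<phi>' (cmod w)"
  shows "cmod (F z - F 0) \<le> \<phi> (cmod z) - \<phi> 0"
proof -
  have mem: "of_real t * z \<in> ball 0 r" if "0 \<le> t" "t \<le> 1" for t :: real
  proof -
    have "cmod (of_real t * z) \<le> cmod z"
      using that by (simp add: norm_mult mult_left_le_one_le)
    with z show ?thesis by simp
  qed
  have dF: "((\<lambda>t. F (of_real t * z)) has_vector_derivative z * deriv F (of_real t * z)) (at t)"
    if "0 \<le> t" "t \<le> 1" for t
  proof -
    have "(F has_field_derivative deriv F (of_real t * z)) (at (of_real t * z))"
      using F mem[OF that] by (intro holomorphic_derivI) auto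
    moreover have "((\<lambda>t. of_real t * z) has_vector_derivative z) (at t)"
      by (auto intro!: derivative_eq_intros)
    ultimately show ?thesis
      using field_vector_diff_chain_at[of "\<lambda>t. of_real t * z" z t F] by (simp add: o_def)
  qed
  have d\<phi>: "((\<lambda>t. \<phi> (t * cmod z)) has_real_derivative cmod z * \<phi>' (t * cmod z)) (at t)" for t
  proof -
    have "((\<lambda>t. t * cmod z) has_real_derivative cmod z) (at t)"
      by (auto intro!: derivative_eq_intros)
    from DERIV_chain2[OF \<phi> this] show ?thesis by (simp add: mult.commute)
  qed
  have "norm (F (of_real 1 * z) - F (of_real 0 * z)) \<le> \<phi> (1 * cmod z) - \<phi> (0 * cmod z)"
  proof (rule differentiable_bound_general)
    show "continuous_on {0..1} (\<lambda>t. F (of_real t * z))"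
      by (intro continuous_at_imp_continuous_on ballI has_vector_derivative_continuous[OF dF]) auto
    show "continuous_on {0..1} (\<lambda>t. \<phi> (t * cmod z))"
      using d\<phi> by (intro continuous_at_imp_continuous_on) (auto intro: DERIV_isCont)
    show "((\<lambda>t. \<phi> (t * cmod z)) has_vector_derivative cmod z * \<phi>' (t * cmod z)) (at t)" for t
      using d\<phi> by (simp add: has_real_derivative_iff_has_vector_derivative)
    show "norm (z * deriv F (of_real t * z)) \<le> cmod z * \<phi>' (t * cmod z)" if "0 < t" "t < 1" for t
      using bound[OF mem, of t] that by (simp add: norm_mult mult_left_mono)
  qed (use dF in auto)
  then show ?thesis by simp
qed

text \<open>Induction on \<open>m\<close> with \<open>F\<close> arbitrary: the induction hypothesis
  for \<open>deriv F\<close> is a polynomial bound \<open>\<phi>'\<close>, and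
  \<open>radial_bound\<close> integrates it to \<open>\<phi>\<close>.\<close>

lemma taylor_norm_bound:
  fixes F :: "complex \<Rightarrow> complex"
  assumes "F holomorphic_on ball 0 r" and "z \<in> ball 0 r"
    and "\<And>w. w \<in> ball 0 r \<Longrightarrow> cmod ((deriv ^^ m) F w) \<le> M"
  shows "cmod (F z) \<le> (\<Sum>j<m. cmod ((deriv ^^ j) F 0) / fact j * cmod z ^ j)
                        + M / fact m * cmod z ^ m"
  using assms
proof (induction m arbitrary: F z)
  case 0
  then show ?case by simp
next
  case (Suc m)
  define c where "c j = cmod ((deriv ^^ j) F 0)" for j
  define \<phi> where "\<phi> t = (\<Sum>j<m. c (Suc j) / fact (Suc j) * t ^ Suc j) + M / fact (Suc m) * t ^ Suc m"
    for t :: real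
  define \<phi>' where "\<phi>' t = (\<Sum>j<m. c (Suc j) / fact j * t ^ j) + M / fact m * t ^ m"
    for t :: real
  have mono: "((\<lambda>t. b / fact (Suc j) * t ^ Suc j) has_real_derivative b / fact j * t ^ j) (at t)"
    for b t :: real and j
    using DERIV_cmult[OF DERIV_pow[of "Suc j" t UNIV], of "b / fact (Suc j)"]
    by (simp add: divide_simps del: power_Suc)
  have "cmod (F z - F 0) \<le> \<phi> (cmod z) - \<phi> 0"
  proof (rule radial_bound[OF Suc.prems(1,2), where \<phi>' = \<phi>'])
    show "(\<phi> has_real_derivative \<phi>' t) (at t)" for t
      unfolding \<phi>_def \<phi>'_def by (intro DERIV_add DERIV_sum mono)
    show "cmod (deriv F w) \<le> \<phi>' (cmod w)" if w: "w \<in> ball 0 r" for w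
      using Suc.IH[of "deriv F" w] Suc.prems w
      by (simp add: holomorphic_deriv \<phi>'_def c_def funpow_swap1)
  qed
  moreover have "\<phi> 0 = 0"
    by (simp add: \<phi>_def)
  moreover have "cmod (F z) \<le> cmod (F 0) + cmod (F z - F 0)"
    by (metis add.commute diff_add_cancel norm_triangle_ineq)
  ultimately show ?case
    by (simp add: \<phi>_def c_def sum.lessThan_Suc_shift del: sum.lessThan_Suc power_Suc fact_Suc)
qed

text \<open>The derivative of \<open>w * deriv g w - g w\<close> is \<open>w\<close> times the
  second derivative of \<open>g\<close>, so the Taylor bound for the latter gains one factor
  \<open>cmod w\<close> before integration. Integrating \<open>t^(k+1) / k!\<close> produces the
  weights, as 1/(k! (k+2)) = (k+1)/(k+2)!.\<close>

lemma radial_defect_bound: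
  fixes g :: "complex \<Rightarrow> complex"
  assumes g: "g holomorphic_on ball 0 r" and z: "z \<in> ball 0 r"
    and bound: "\<And>w. w \<in> ball 0 r \<Longrightarrow> cmod ((deriv ^^ (m + 2)) g w) \<le> M"
  shows "cmod (z * deriv g z - g z + g 0)
           \<le> (\<Sum>k<m. (real k + 1) / fact (k + 2) * cmod ((deriv ^^ (k + 2)) g 0) * cmod z ^ (k + 2))
             + (real m + 1) / fact (m + 2) * M * cmod z ^ (m + 2)"
proof -
  define c where "c j = cmod ((deriv ^^ (j + 2)) g 0)" for j
  define \<phi> where "\<phi> t = (\<Sum>k<m. (real k + 1) / fact (k + 2) * c k * t ^ (k + 2))
      + (real m + 1) / fact (m + 2) * M * t ^ (m + 2)" for t :: real
  define \<phi>' where "\<phi>' t = (\<Sum>k<m. c k / fact k * t ^ Suc k) + M / fact m * t ^ Suc m"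
    for t :: real
  define V where "V = (\<lambda>w. w * deriv g w - g w)"
  have mono: "((\<lambda>t. (real j + 1) / fact (j + 2) * b * t ^ (j + 2))
      has_real_derivative b / fact j * t ^ Suc j) (at t)" for b t :: real and j
  proof -
    have "(real j + 1) / fact (j + 2) * b * (real (j + 2) * t ^ (j + 2 - 1)) = b / fact j * t ^ Suc j"
      by (simp add: divide_simps)
    then show ?thesis
      using DERIV_cmult[OF DERIV_pow[of "j + 2" t UNIV], of "(real j + 1) / fact (j + 2) * b"]
      by (simp del: power_Suc)
  qed
  have g': "deriv g holomorphic_on ball 0 r" and g'': "deriv (deriv g) holomorphic_on ball 0 r"
    by (intro holomorphic_deriv[OF _ open_ball] g)+
  have "cmod (V z - V 0) \<le> \<phi> (cmod z) - \<phi> 0"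
  proof (rule radial_bound[where r = r and \<phi>' = \<phi>'])
    show "V holomorphic_on ball 0 r"
      unfolding V_def by (intro holomorphic_on_diff holomorphic_on_mult holomorphic_on_ident g g')
    show "(\<phi> has_real_derivative \<phi>' t) (at t)" for t
      unfolding \<phi>_def \<phi>'_def by (intro DERIV_add DERIV_sum mono)
    show "cmod (deriv V w) \<le> \<phi>' (cmod w)" if w: "w \<in> ball 0 r" for w
    proof -
      have "(V has_field_derivative w * deriv (deriv g) w) (at w)"
        unfolding V_def
        by (rule derivative_eq_intros holomorphic_derivI[OF g] holomorphic_derivI[OF g'] refl w open_ball)+
          (simp)
      then have "cmod (deriv V w) = cmod w * cmod (deriv (deriv g) w)"
        by (simp add: DERIV_imp_deriv norm_mult)
      also have "\<dots> \<le> cmod w * ((\<Sum>j<m. c j / fact j * cmod w ^ j) + M / fact m * cmod w ^ m)"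
        using taylor_norm_bound[OF g'' w, of m M] bound
        by (intro mult_left_mono) (simp_all add: c_def funpow_swap1)
      also have "\<dots> = \<phi>' (cmod w)"
        by (simp add: \<phi>'_def distrib_left sum_distrib_left mult_ac)
      finally show ?thesis .
    qed
  qed (use z in auto)
  moreover have "\<phi> 0 = 0"
    by (simp add: \<phi>_def)
  ultimately show ?thesis
    by (simp add: V_def \<phi>_def c_def)
qed

section \<open>Injectivity of \<open>g z / z\<close>\<close>

lemma quotient_by_id_injective:
  fixes g :: "complex \<Rightarrow> complex"
  assumes g: "g holomorphic_on ball 0 1" and g0: "g 0 = 1"
    and M: "\<And>w. w \<in> ball 0 1 \<Longrightarrow> cmod ((deriv ^^ (m + 2)) g w) \<le> M"
    and sum: "(\<Sum>k<m. (real k + 1) / fact (k + 2) * cmod ((deriv ^^ (k + 2)) g 0))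
               + (real m + 1) / fact (m + 2) * M \<le> 1"
    and z: "z \<in> ball 0 1 - {0}" and w: "w \<in> ball 0 1 - {0}"
    and eq: "g z / z = g w / w"
  shows "z = w"
proof -
  have "M \<ge> 0"
    by (rule order_trans[OF norm_ge_zero M[of 0]]) simp
  have defect: "cmod (u * deriv g u - g u + g 0) \<le> cmod u ^ 2" if u: "u \<in> ball 0 1" for u
  proof -
    \<comment> \<open>Lowering every power to \<open>cmod u ^ 2\<close> leaves exactly the
      coefficient sum assumed to be at most 1; the square later cancels the \<open>u\<^sup>2\<close>
      in the denominator of \<open>deriv H u\<close>.\<close>
    have pow: "cmod u ^ (k + 2) \<le> cmod u ^ 2" for k
      using u by (intro power_decreasing) auto
    have "cmod (u * deriv g u - g u + g 0)
        \<le> (\<Sum>k<m. (real k + 1) / fact (k + 2) * cmod ((deriv ^^ (k + 2)) g 0) * cmod u ^ (k + 2))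
          + (real m + 1) / fact (m + 2) * M * cmod u ^ (m + 2)"
      by (rule radial_defect_bound[OF g u M])
    also have "\<dots> \<le> (\<Sum>k<m. (real k + 1) / fact (k + 2) * cmod ((deriv ^^ (k + 2)) g 0) * cmod u ^ 2)
          + (real m + 1) / fact (m + 2) * M * cmod u ^ 2"
      using \<open>M \<ge> 0\<close> by (intro add_mono sum_mono mult_left_mono pow) auto
    also have "\<dots> = ((\<Sum>k<m. (real k + 1) / fact (k + 2) * cmod ((deriv ^^ (k + 2)) g 0))
          + (real m + 1) / fact (m + 2) * M) * cmod u ^ 2"
      by (simp only: distrib_right sum_distrib_right)
    also have "\<dots> \<le> 1 * cmod u ^ 2"
      by (rule mult_right_mono[OF sum]) simp
    finally show ?thesis by simp
  qed
  define H where "H = (\<lambda>u. if u = 0 then deriv g 0 else (g u - g 0) / (u - 0))"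
  have H: "H holomorphic_on ball 0 1"
    unfolding H_def by (rule pole_lemma_open[OF g open_ball])
  have H'_away: "cmod (deriv H u) \<le> 1" if u: "u \<in> ball 0 1 - {0}" for u
  proof -
    have "((\<lambda>u. (g u - g 0) / (u - 0)) has_field_derivative (u * deriv g u - g u + g 0) / u\<^sup>2) (at u)"
      using u holomorphic_derivI[OF g open_ball, of u UNIV]
      by (auto intro!: derivative_eq_intros simp: power2_eq_square algebra_simps)
    moreover have "open (- {0 :: complex})"
      by (simp add: open_Compl)
    ultimately have "(H has_field_derivative (u * deriv g u - g u + g 0) / u\<^sup>2) (at u)"
      by (rule has_field_derivative_transform_within_open) (use u in \<open>auto simp: H_def\<close>)
    then have "cmod (deriv H u) = cmod (u * deriv g u - g u + g 0) / cmod u ^ 2"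
      by (simp add: DERIV_imp_deriv norm_divide norm_power)
    also have "\<dots> \<le> 1"
      using defect[of u] u by (simp add: divide_le_eq)
    finally show ?thesis .
  qed
  have H': "cmod (deriv H u) \<le> 1" if u: "u \<in> ball 0 1" for u
  proof (cases "u = 0")
    case True
    \<comment> \<open>The quotient formula for \<open>deriv H\<close> says nothing at the origin;
      the bound gets there by continuity.\<close>
    have "deriv H holomorphic_on ball 0 1"
      using H by (auto intro: holomorphic_deriv)
    then have "isCont (deriv H) 0"
      by (meson centre_in_ball continuous_on_eq_continuous_at holomorphic_on_imp_continuous_on
          open_ball zero_less_one)
    then have "((\<lambda>u. cmod (deriv H u)) \<longlongrightarrow> cmod (deriv H 0)) (at 0)"
      by (intro tendsto_norm) (simp add: isCont_def)
    moreover have "eventually (\<lambda>u. cmod (deriv H u) \<le> 1) (at 0)"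
      using eventually_at_in_open[OF open_ball, of 0 0 1]
      by (rule eventually_mono) (simp_all add: H'_away)
    ultimately show ?thesis
      unfolding True by (rule tendsto_upperbound) simp
  qed (use u H'_away in auto)
  have lip: "cmod (H z - H w) \<le> 1 * cmod (z - w)"
    using z w H' holomorphic_derivI[OF H open_ball]
    by (intro field_differentiable_bound[of "ball 0 1" H "deriv H"]) auto
  have "H z = g z / z - 1 / z" "H w = g w / w - 1 / w"
    using z w by (simp_all add: H_def g0 diff_divide_distrib)
  then have "H z - H w = 1 / w - 1 / z"
    by (simp add: eq)
  also have "\<dots> = (z - w) / (z * w)"
    using z w by (simp add: divide_simps)
  finally have "H z - H w = (z - w) / (z * w)" .
  then have "cmod (z - w) = cmod (z * w) * cmod (H z - H w)"
    using z w by (simp add: norm_divide)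
  also have "\<dots> \<le> cmod (z * w) * cmod (z - w)"
    using lip by (intro mult_left_mono) auto
  finally have "(1 - cmod (z * w)) * cmod (z - w) \<le> 0"
    by (simp add: algebra_simps)
  \<comment> \<open>Strictness comes from the openness of the disc, so the non-strict bound on
    \<open>deriv H\<close> suffices.\<close>
  moreover have "cmod (z * w) < 1"
    using z w mult_strict_mono'[of "cmod z" 1 "cmod w" 1] by (simp add: norm_mult)
  ultimately show ?thesis
    by (auto simp: mult_le_0_iff)
qed

section \<open>Analyticity of \<open>g_of f\<close> on the disc\<close>

text \<open>\<open>remove_sings\<close> takes limits, and near \<open>z\<close> the quotient agrees
  with the continuous \<open>G\<close> except perhaps at finitely many points.\<close>

lemma g_of_eq:
  assumes G: "G holomorphic_on ball 0 1"
    and eq: "\<And>z. z \<in> ball 0 1 - {0, q} \<Longrightarrow> z / f z = G z"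
    and z: "z \<in> ball 0 1"
  shows "g_of f z = G z"
proof -
  \<comment> \<open>Only exceptional points other than \<open>z\<close> are cut out;
    \<open>z\<close> may itself be exceptional, since a limit at \<open>z\<close> ignores the value
    there.\<close>
  define S where "S = ball 0 1 - ({0, q} - {z})"
  have "open S" "z \<in> S"
    using z by (auto simp: S_def intro!: open_Diff finite_imp_closed)
  then have "eventually (\<lambda>u. u \<in> S - {z}) (at z)"
    by (rule eventually_at_in_open)
  then have "eventually (\<lambda>u. G u = u / f u) (at z)"
    by eventually_elim (auto simp: S_def eq)
  moreover have "(G \<longlongrightarrow> G z) (at z)"
    using G z by (meson continuous_on_eq_continuous_at holomorphic_on_imp_continuous_on
        isCont_def open_ball)
  ultimately have "((\<lambda>u. u / f u) \<longlongrightarrow> G z) (at z)"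
    by (rule Lim_transform_eventually[rotated])
  then show ?thesis
    unfolding g_of_def by (rule remove_sings_eqI)
qed

text \<open>Translates \<open>nonvanishing\<close>, which speaks of sphere values, into plain values
  of \<open>f\<close>: off \<open>p\<close> the function is holomorphic, so \<open>to_sphere\<close>
  keeps its value.\<close>

lemma class_A_nonzero:
  assumes "f \<in> class_A p" and "nonvanishing f" and z: "z \<in> ball 0 1 - {0, of_real p}"
  shows "\<not> is_pole f z" and "f z \<noteq> 0"
proof -
  show "\<not> is_pole f z"
    using assms not_is_pole_holomorphic[of "ball 0 1 - {of_real p}" z f]
    by (auto simp: class_A_def open_delete)
  moreover have "to_sphere f z \<noteq> Some 0"
    using assms unfolding nonvanishing_def by blast
  ultimately show "f z \<noteq> 0"
    by (simp add: to_sphere_def)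
qed

text \<open>The extension of \<open>z / f z\<close> is glued from two open pieces covering the disc.
  Off 0, the reciprocal of \<open>f\<close> extends by 0 across the pole. On
  \<open>ball 0 p\<close>, which misses the pole, \<open>f z / z\<close> extends to a holomorphic
  function without zeros.\<close>

lemma g_of_class_A:
  assumes p: "0 < p" "p < 1" and f: "f \<in> class_A p" and nv: "nonvanishing f"
  shows "g_of f holomorphic_on ball 0 1" and "g_of f 0 = 1"
    and "\<And>z. z \<in> ball 0 1 - {0, of_real p} \<Longrightarrow> g_of f z = z / f z"
proof -
  let ?p = "of_real p :: complex"
  define G where "G z = (if z = 0 then 1 else if z = ?p then 0 else z / f z)" for z
  have hol: "f holomorphic_on ball 0 1 - {?p}" and pole: "is_pole f ?p"
    and f0: "f 0 = 0" and f0': "deriv f 0 = 1"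
    using f by (auto simp: class_A_def)
  have "(\<lambda>z. if z = ?p then 0 else inverse (f z)) holomorphic_on ball 0 1 - {0}"
  proof (rule is_pole_inverse_holomorphic)
    show "f holomorphic_on ball 0 1 - {0} - {?p}"
      using hol by (rule holomorphic_on_subset) auto
    show "\<forall>x\<in>ball 0 1 - {0} - {?p}. f x \<noteq> 0"
      using class_A_nonzero[OF f nv] by auto
  qed (use pole in auto)
  then have "(\<lambda>z. z * (if z = ?p then 0 else inverse (f z))) holomorphic_on ball 0 1 - {0}"
    by (intro holomorphic_intros)
  then have G_away: "G holomorphic_on ball 0 1 - {0}"
    by (rule holomorphic_transform) (auto simp: G_def field_simps)
  define F where "F = (\<lambda>z. if z = 0 then deriv f 0 else (f z - f 0) / (z - 0))"
  have hol_F: "F holomorphic_on ball 0 p"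
    unfolding F_def by (intro pole_lemma_open holomorphic_on_subset[OF hol]) (use p in auto)
  have "f z \<noteq> 0" if "z \<in> ball 0 p" "z \<noteq> 0" for z
    using that p by (intro class_A_nonzero(2)[OF f nv]) auto
  then have "F z \<noteq> 0" if "z \<in> ball 0 p" for z
    using that by (auto simp: F_def f0 f0')
  then have "(\<lambda>z. 1 / F z) holomorphic_on ball 0 p"
    by (intro holomorphic_intros hol_F) auto
  then have "G holomorphic_on ball 0 p"
    by (rule holomorphic_transform) (use p in \<open>auto simp: G_def F_def f0 f0'\<close>)
  with G_away have "G holomorphic_on (ball 0 1 - {0}) \<union> ball 0 p"
    by (rule holomorphic_on_Un) auto
  then have G: "G holomorphic_on ball 0 1"
    by (rule holomorphic_on_subset) (use p in auto)
  have eq: "g_of f z = G z" if "z \<in> ball 0 1" for z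
    using that by (intro g_of_eq[OF G, of ?p]) (auto simp: G_def)
  show "g_of f holomorphic_on ball 0 1"
    using G by (rule holomorphic_transform) (simp add: eq)
  show "g_of f 0 = 1" by (simp add: eq G_def)
  show "g_of f z = z / f z" if "z \<in> ball 0 1 - {0, ?p}" for z
    using that by (simp add: eq G_def)
qed

section \<open>The sufficient condition for univalence\<close>

theorem coeff_bound_imp_univalent:
  assumes p: "0 < p" "p < 1" and f: "f \<in> class_A p" and nv: "nonvanishing f" and n: "n \<ge> 3"
    and bound: "\<And>z. z \<in> ball 0 1 \<Longrightarrow> coeff_bound n f z \<le> 1"
  shows "univalent_in_disc f"
proof -
  let ?p = "of_real p :: complex"
  \<comment> \<open>With \<open>m = n - 2\<close> the range \<open>{0..n - 3}\<close> becomes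
    \<open>{..<m}\<close>; truncated subtraction makes \<open>n \<ge> 3\<close> essential
    here.\<close>
  define m where "m = n - 2"
  define g where "g = g_of f"
  note g = g_of_class_A[OF p f nv, folded g_def]
  define S where "S = (\<Sum>k<m. (real k + 1) / fact (k + 2) * cmod ((deriv ^^ (k + 2)) g 0))"
  define b :: real where "b = (real m + 1) / fact (m + 2)"
  have n_eq: "n = m + 2" and range: "{0..n - 3} = {..<m}"
    using n by (auto simp: m_def)
  have S: "S + b * cmod ((deriv ^^ (m + 2)) g z) \<le> 1" if "z \<in> ball 0 1" for z
    using bound[OF that] unfolding coeff_bound_def alpha_def norm_minus_cancel g_def[symmetric] range
    by (simp add: S_def b_def n_eq add.commute[of 1] del: funpow.simps fact_Suc add_2_eq_Suc')
  have "b > 0" by (simp add: b_def)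
  \<comment> \<open>The largest \<open>n\<close>-th derivative that the hypothesis permits; it turns
    the pointwise bounds into one uniform bound, with \<open>S + b * M = 1\<close>.\<close>
  define M where "M = (1 - S) / b"
  have M: "cmod ((deriv ^^ (m + 2)) g z) \<le> M" if "z \<in> ball 0 1" for z
    using S[OF that] \<open>b > 0\<close> by (simp add: M_def pos_le_divide_eq mult.commute del: funpow.simps)
  have sum: "S + b * M \<le> 1"
    using \<open>b > 0\<close> by (simp add: M_def)
  have pole: "is_pole f ?p"
    using f by (simp add: class_A_def)
  have "f 0 = 0" "\<not> is_pole f 0"
    using f p not_is_pole_holomorphic[of "ball 0 1 - {?p}" 0 f]
    by (auto simp: class_A_def open_delete)
  have "z = w" if z: "z \<in> ball 0 1" and w: "w \<in> ball 0 1" and eq: "to_sphere f z = to_sphere f w" for z w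
  proof -
    have sphere: "to_sphere f u = (if u = ?p then None else Some (f u))" if "u \<in> ball 0 1" for u
      using that class_A_nonzero(1)[OF f nv, of u] pole \<open>\<not> is_pole f 0\<close>
      by (cases "u = 0") (auto simp: to_sphere_def)
    have zero: "f u = 0 \<longleftrightarrow> u = 0" if "u \<in> ball 0 1" "u \<noteq> ?p" for u
      using that class_A_nonzero(2)[OF f nv, of u] \<open>f 0 = 0\<close> by auto
    \<comment> \<open>Infinity is taken only at \<open>p\<close> and the value 0 only at 0;
      elsewhere equal values of \<open>f\<close> have equal reciprocals
      \<open>g z / z\<close>.\<close>
    consider "z = ?p \<or> w = ?p" | "z \<noteq> ?p" "w \<noteq> ?p" "z = 0 \<or> w = 0"
      | "z \<notin> {0, ?p}" "w \<notin> {0, ?p}"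
      by blast
    then show ?thesis
    proof cases
      case 1
      then show ?thesis
        using eq z w by (simp add: sphere split: if_splits)
    next
      case 2
      then have "f z = f w"
        using eq by (simp add: sphere[OF z] sphere[OF w])
      then show ?thesis
        using 2 zero[OF z] zero[OF w] by metis
    next
      case 3
      then have "f z = f w"
        using eq by (simp add: sphere[OF z] sphere[OF w])
      then have "g z / z = g w / w"
        using 3 z w by (simp add: g(3))
      then show ?thesis
        by (rule quotient_by_id_injective[OF g(1,2) M sum[unfolded S_def b_def], rotated -1])
          (use 3 z w in auto)
    qed
  qed
  then show ?thesis
    by (auto simp: univalent_in_disc_def intro!: inj_onI)
qed

section \<open>The extremal functions\<close>

lemma class_A_quotientI:
  assumes p: "0 < p" "p < 1" and G: "G holomorphic_on ball 0 1"
    and G0: "G 0 = 1" and Gp: "G (of_real p) = 0" and G'p: "deriv G (of_real p) \<noteq> 0"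
    and nz: "\<And>z. z \<in> ball 0 1 - {of_real p} \<Longrightarrow> G z \<noteq> 0"
  shows "(\<lambda>z. z / G z) \<in> class_A p" and "nonvanishing (\<lambda>z. z / G z)"
proof -
  let ?p = "of_real p :: complex"
  have pmem: "?p \<in> ball 0 1" using p by simp
  have hol: "(\<lambda>z. z / G z) holomorphic_on ball 0 1 - {?p}"
    using nz by (intro holomorphic_intros holomorphic_on_subset[OF G]) auto
  have pole: "is_pole (\<lambda>z. z / G z) ?p"
  proof (rule is_pole_divide)
    have "isCont G ?p"
      using G pmem by (meson continuous_on_eq_continuous_at holomorphic_on_imp_continuous_on open_ball)
    then have "(G \<longlongrightarrow> 0) (at ?p)"
      using Gp by (simp add: isCont_def)
    moreover have "eventually (\<lambda>z. G z \<noteq> 0) (at ?p)"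
      using eventually_at_in_open[OF open_ball pmem] by eventually_elim (rule nz)
    ultimately show "filterlim G (at 0) (at ?p)"
      by (rule filterlim_atI)
  qed (use p in auto)
  \<comment> \<open>\<open>K\<close> is \<open>G\<close> with its simple zero at \<open>p\<close>
    divided out, so \<open>z / K z\<close> is the nonvanishing factor at the pole that shows its
    order to be -1.\<close>
  define K where "K = (\<lambda>z. if z = ?p then deriv G ?p else (G z - G ?p) / (z - ?p))"
  have K: "K holomorphic_on ball 0 1"
    unfolding K_def by (rule pole_lemma_open[OF G open_ball])
  have K_nz: "K z \<noteq> 0" if "z \<in> ball 0 1" for z
    using that nz G'p by (auto simp: K_def Gp)
  have "zorder (\<lambda>z. z / G z) ?p = - 1"
  proof (rule zorder_eqI)
    show "(\<lambda>z. z / K z) holomorphic_on ball 0 1"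
      using K K_nz by (intro holomorphic_intros) auto
    show "?p / K ?p \<noteq> 0"
      using K_nz[OF pmem] p by simp
    show "z / G z = z / K z * (z - ?p) powi - 1" if "z \<noteq> ?p" for z
      using that by (simp add: K_def Gp power_int_minus divide_simps)
  qed (use pmem in auto)
  moreover have "((\<lambda>z. z / G z) has_field_derivative 1) (at 0)"
    using holomorphic_derivI[OF G open_ball, of 0 UNIV] G0
    by (auto intro!: derivative_eq_intros)
  ultimately show "(\<lambda>z. z / G z) \<in> class_A p"
    using hol pole by (simp add: class_A_def DERIV_imp_deriv)
  show "nonvanishing (\<lambda>z. z / G z)"
    unfolding nonvanishing_def
  proof
    \<comment> \<open>At \<open>p\<close> the HOL value of \<open>z / G z\<close> is 0 by division
      by zero; it is the pole that makes the sphere value \<open>None\<close>.\<close>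
    show "to_sphere (\<lambda>z. z / G z) z \<noteq> Some 0" if "z \<in> ball 0 1 - {0}" for z
      using that nz[of z] pole by (cases "z = ?p") (auto simp: to_sphere_def)
  qed
qed

text \<open>Bernoulli's inequality \<open>1 + m (p - 1) < p^m\<close>, rearranged. It serves to
  exclude zeros of the extremal trinomial other than \<open>p\<close> in the disc.\<close>

lemma strict_Bernoulli:
  fixes p :: real
  assumes "0 < p" "p \<noteq> 1" "m \<ge> 2"
  shows "real m * p < real m - 1 + p ^ m"
  using \<open>m \<ge> 2\<close>
proof (induction m rule: dec_induct)
  case base
  have "0 < (1 - p)\<^sup>2" using assms by simp
  then show ?case by (simp add: power2_eq_square algebra_simps)
next
  case (step m)
  have "p * (real m * p) < p * (real m - 1 + p ^ m)"
    using step.IH assms by (intro mult_strict_left_mono)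
  moreover have "0 \<le> real m * (1 - p)\<^sup>2" by simp
  ultimately show ?case by (simp add: power2_eq_square algebra_simps)
qed

text \<open>From order 2 on the linear part disappears. For \<open>j > m\<close> the truncated
  \<open>Suc m - j\<close> is 0, so the Pochhammer factor vanishes, as it should.\<close>

lemma higher_deriv_trinomial:
  fixes a c z :: complex
  assumes "j \<ge> 2"
  shows "(deriv ^^ j) (\<lambda>z. 1 - a * z + c * z ^ m) z
           = c * pochhammer (of_nat (Suc m - j)) j * z ^ (m - j)"
proof -
  have lin: "(deriv ^^ j) (\<lambda>z. 1 - a * z) z = 0"
    using assms
    by (subst higher_deriv_diff[of _ UNIV])
      (auto intro!: holomorphic_intros simp: higher_deriv_linear)
  have "(deriv ^^ j) (\<lambda>z. 1 - a * z + c * z ^ m) z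
      = (deriv ^^ j) (\<lambda>z. 1 - a * z) z + (deriv ^^ j) (\<lambda>z. c * z ^ m) z"
    by (rule higher_deriv_add[of _ UNIV]) (auto intro!: holomorphic_intros)
  also have "(deriv ^^ j) (\<lambda>z. c * z ^ m) z = c * (deriv ^^ j) (\<lambda>z. z ^ m) z"
    by (rule higher_deriv_cmult[of _ UNIV]) (auto intro!: holomorphic_intros)
  finally show ?thesis
    using lin higher_deriv_power[of j 0 m z] by simp
qed

text \<open>The exponent \<open>m\<close> is kept apart from the order \<open>n\<close> so that
  \<open>m = 2\<close> yields \<open>k_fun\<close> for every \<open>n\<close> and
  \<open>m = n\<close> yields \<open>f_fun p n\<close>. The one nonlinear coefficient contributes
  exactly 1: through the sum if \<open>m < n\<close>, through the \<open>n\<close>-th derivative if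
  \<open>m = n\<close>.\<close>

lemma f_fun_extremal:
  assumes p: "0 < p" "p < 1" and m: "m \<ge> 2"
  shows "f_fun p m \<in> class_A p" and "nonvanishing (f_fun p m)"
    and "\<And>n z. n \<ge> 3 \<Longrightarrow> m \<le> n \<Longrightarrow> z \<in> ball 0 1 \<Longrightarrow> coeff_bound n (f_fun p m) z = 1"
proof -
  let ?p = "of_real p :: complex"
  define c where "c = 1 / (real m - 1)"
  define a where "a = 1 / p + c * p ^ (m - 1)"
  define G where "G = (\<lambda>z :: complex. 1 - of_real a * z + of_real c * z ^ m)"
  have f_eq: "f_fun p m = (\<lambda>z. z / G z)"
    by (simp add: f_fun_def G_def a_def c_def fun_eq_iff)
  have c: "c > 0" "c * (real m - 1) = 1"
    using m by (auto simp: c_def)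
  have pm: "p ^ m = p * p ^ (m - 1)"
    using m by (simp add: power_eq_if)
  have "p * (c * real m) < p * a"
  proof -
    have "c * (real m * p) < c * (real m - 1 + p ^ m)"
      using strict_Bernoulli[of p m] p m c by (intro mult_strict_left_mono) auto
    also have "\<dots> = 1 + c * p ^ m"
      using c by (simp add: distrib_left)
    also have "\<dots> = p * a"
      using p by (simp add: a_def pm distrib_left mult_ac)
    finally show ?thesis by (simp add: mult_ac)
  qed
  then have a: "c * real m < a"
    using p by simp
  have G_hol: "G holomorphic_on A" for A
    unfolding G_def by (intro holomorphic_intros)
  have Gp: "G ?p = 0"
  proof -
    have "1 - a * p + c * p ^ m = 0"
      using p by (simp add: a_def pm algebra_simps)
    then have "complex_of_real (1 - a * p + c * p ^ m) = 0"
      by (simp only: of_real_0)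
    then show ?thesis by (simp add: G_def)
  qed
  have Gnz: "G z \<noteq> 0" if z: "z \<in> ball 0 1 - {?p}" for z
  proof
    assume "G z = 0"
    \<comment> \<open>Dividing \<open>G z - G ?p = 0\<close> by \<open>z - ?p\<close> gives
      \<open>c * s = a\<close>, impossible because \<open>s\<close> has \<open>m\<close> terms of
      modulus at most 1 and \<open>c * m < a\<close>.\<close>
    define s where "s = (\<Sum>i<m. z ^ i * ?p ^ (m - 1 - i))"
    have "z ^ m - ?p ^ m = (z - ?p) * s"
      using diff_power_eq_sum[of z "m - 1" ?p] m by (simp add: s_def)
    moreover have "of_real c * (z ^ m - ?p ^ m) = of_real a * (z - ?p) + (G z - G ?p)"
      by (simp add: G_def algebra_simps)
    ultimately have "(z - ?p) * (of_real c * s) = (z - ?p) * of_real a"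
      by (simp add: mult_ac \<open>G z = 0\<close> Gp)
    then have "of_real c * s = of_real a"
      using z by simp
    then have "c * cmod s = \<bar>a\<bar>"
      using c by (metis abs_of_pos norm_mult norm_of_real)
    moreover have "cmod s \<le> (\<Sum>i<m. 1)"
      unfolding s_def
    proof (rule sum_norm_le)
      show "cmod (z ^ i * ?p ^ (m - 1 - i)) \<le> 1" for i
        using z p by (auto simp: norm_mult norm_power intro!: mult_le_one power_le_one)
    qed
    then have "c * cmod s \<le> c * real m"
      using c by simp
    ultimately show False
      using a by linarith
  qed
  have G'p: "deriv G ?p \<noteq> 0"
  proof -
    have "(G has_field_derivative of_real (c * real m * p ^ (m - 1) - a)) (at ?p)"
      unfolding G_def by (auto intro!: derivative_eq_intros)
    moreover have "c * real m * p ^ (m - 1) \<le> c * real m * 1"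
      using p c by (intro mult_left_mono power_le_one) auto
    ultimately show ?thesis
      using a by (simp add: DERIV_imp_deriv flip: of_real_mult of_real_power of_real_diff)
  qed
  show "f_fun p m \<in> class_A p" and "nonvanishing (f_fun p m)"
    unfolding f_eq using class_A_quotientI[OF p G_hol _ Gp G'p Gnz] m by (auto simp: G_def)
  \<comment> \<open>The only exceptional point is 0: where \<open>G\<close> vanishes, division by
    zero gives \<open>z / (z / G z) = 0\<close>, which is again \<open>G z\<close>.\<close>
  have g_eq: "g_of (f_fun p m) z = G z" if "z \<in> ball 0 1" for z
    using that by (intro g_of_eq[OF G_hol, of 0]) (auto simp: f_eq)
  have g_hol: "g_of (f_fun p m) holomorphic_on ball 0 1"
    using G_hol by (rule holomorphic_transform) (simp add: g_eq)
  have deriv: "(deriv ^^ j) (g_of (f_fun p m)) z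
      = of_real c * pochhammer (of_nat (Suc m - j)) j * z ^ (m - j)"
    if "z \<in> ball 0 1" "j \<ge> 2" for z j
    using higher_deriv_transform_within_open[OF g_hol G_hol open_ball that(1) g_eq, of j]
      higher_deriv_trinomial[OF that(2)] by (simp add: G_def)
  have top: "cmod (of_real c * pochhammer (of_nat (Suc m - m)) m) = c * fact m"
    using c by (simp add: norm_mult flip: pochhammer_fact)
  have alpha: "cmod (alpha (f_fun p m) k) = (if k = m - 2 then c * fact m else 0)" for k
  proof (cases "k + 2" m rule: linorder_cases)
    case less
    then show ?thesis
      unfolding alpha_def norm_minus_cancel by (subst deriv) (auto simp: power_0_left)
  next
    case equal
    then show ?thesis
      unfolding alpha_def norm_minus_cancel using top by (subst deriv) auto
  next
    case greater
    then have "Suc m - (k + 2) = 0" "k \<noteq> m - 2" using m by auto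
    then show ?thesis
      unfolding alpha_def norm_minus_cancel by (subst deriv) (auto simp: pochhammer_0_left)
  qed
  show "coeff_bound n (f_fun p m) z = 1" if n: "n \<ge> 3" "m \<le> n" and z: "z \<in> ball 0 1" for n z
  proof -
    have weight: "(real m - 1) / fact m * (c * fact m) = 1"
      using c by (simp add: mult.commute)
    have "(\<Sum>k = 0..n - 3. (real k + 1) / fact (k + 2) * cmod (alpha (f_fun p m) k))
        = (\<Sum>k = 0..n - 3. if k = m - 2 then (real m - 1) / fact m * (c * fact m) else 0)"
    proof (rule sum.cong[OF refl])
      fix k
      show "(real k + 1) / fact (k + 2) * cmod (alpha (f_fun p m) k)
          = (if k = m - 2 then (real m - 1) / fact m * (c * fact m) else 0)"
      proof (cases "k = m - 2")
        case True
        then have "k + 2 = m" "real k + 1 = real m - 1" using m by auto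
        then show ?thesis using True by (simp only: alpha if_True refl)
      qed (simp add: alpha)
    qed
    \<comment> \<open>The index \<open>m - 2\<close> lies in \<open>{0..n - 3}\<close> precisely
      when \<open>m < n\<close>.\<close>
    also have "\<dots> = (if m < n then 1 else 0)"
      unfolding weight using m n by auto
    finally have sum: "(\<Sum>k = 0..n - 3. (real k + 1) / fact (k + 2) * cmod (alpha (f_fun p m) k))
        = (if m < n then 1 else 0)" .
    have "cmod ((deriv ^^ n) (g_of (f_fun p m)) z) = (if m < n then 0 else c * fact m)"
    proof (cases "m = n")
      case True
      then show ?thesis
        using top n by (subst deriv[OF z]) auto
    next
      case False
      then have "Suc m - n = 0" "m < n" using n by auto
      then show ?thesis
        using n by (subst deriv[OF z]) (auto simp: pochhammer_0_left)
    qed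
    then show ?thesis
      using sum weight n by (cases "m = n") (auto simp: coeff_bound_def)
  qed
qed

text \<open>For exponent 2 the trinomial has the roots \<open>p\<close> and \<open>1 / p\<close>,
  hence factors into the denominator of \<open>k_fun\<close> up to the constant
  \<open>- p\<close>.\<close>

lemma k_fun_eq_f_fun:
  assumes "p \<noteq> 0"
  shows "k_fun p = f_fun p 2"
proof
  fix z :: complex
  let ?p = "of_real p :: complex"
  have "(z - ?p) * (1 - ?p * z) = - ?p * (1 - (1 / ?p + ?p) * z + z ^ 2)"
    using assms by (simp add: field_simps power2_eq_square)
  then show "k_fun p z = f_fun p 2 z"
    using assms by (simp add: k_fun_def f_fun_def)
qed

theorem theorem3:
  fixes p :: real
  assumes "0 < p" and "p < 1"
  shows "(\<forall>f \<in> class_A p. \<forall>n\<ge>3. nonvanishing f \<longrightarrow>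
            (\<forall>z\<in>ball 0 1. coeff_bound n f z \<le> 1) \<longrightarrow> univalent_in_disc f)
       \<and> (k_fun p \<in> class_A p \<and> nonvanishing (k_fun p) \<and>
            (\<forall>n\<ge>3. \<forall>z\<in>ball 0 1. coeff_bound n (k_fun p) z = 1))
       \<and> (\<forall>n\<ge>3. f_fun p n \<in> class_A p \<and> nonvanishing (f_fun p n) \<and>
            (\<forall>z\<in>ball 0 1. coeff_bound n (f_fun p n) z = 1))"
proof (intro conjI ballI allI impI)
  fix f n
  assume "f \<in> class_A p" "n \<ge> 3" "nonvanishing f" "\<forall>z\<in>ball 0 1. coeff_bound n f z \<le> 1"
  then show "univalent_in_disc f"
    using coeff_bound_imp_univalent[OF assms] by blast
next
  have k: "k_fun p = f_fun p 2"
    using assms by (intro k_fun_eq_f_fun) simp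
  show "k_fun p \<in> class_A p" "nonvanishing (k_fun p)"
    unfolding k using f_fun_extremal[OF assms, of 2] by auto
  show "coeff_bound n (k_fun p) z = 1" if "n \<ge> 3" "z \<in> ball 0 1" for n z
    unfolding k using f_fun_extremal(3)[OF assms, of 2 n z] that by simp
next
  fix n :: nat and z :: complex
  assume n: "n \<ge> 3"
  then show "f_fun p n \<in> class_A p" "nonvanishing (f_fun p n)"
    using f_fun_extremal[OF assms, of n] by auto
  show "coeff_bound n (f_fun p n) z = 1" if "z \<in> ball 0 1"
    using f_fun_extremal(3)[OF assms, of n n z] n that by simp
qed

end
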